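(* Let $\nu\in\mathbb{N}$, $T>0$, $I\ge1$. Let $V_i$, $i\in\{1,\dots,I\}$, be linear operators (infinitesimal generators) for which there exist $k_i,L_i\in\mathbb{N}$ such that for all $k,L\in\mathbb{N}$ there is $C\in\mathbb{R}_+$ such that for all $f\in\mathcal{C}^{k+k_i,L}_{\mathbf{pol}}$, $$V_if\in\mathcal{C}^{k,L+L_i}_{\mathbf{pol}}\quad\text{and}\quad\|V_if\|_{k,L+L_i}\le C\|f\|_{k+k_i,L}.$$ Let $k^\star=\max_{1\le i\le I}k_i$ and $L^\star=\max_{1\le i\le I}L_i$. Assume that for each $i$ and $t\in[0,T]$, $\hat P^i_t$ is a linear operator mapping $\mathcal{C}^{0,L}_{\mathbf{pol}}$ to $\mathcal{C}^{0,L}_{\mathbf{pol}}$ for every $L\in\mathbb{N}$, and that for all $k,L\in\mathbb{N}$ and $0\le\bar q\le\nu+1$ there is $C$ such that for all $f\in\mathcal{C}^{k+\bar qk_i,L}_{\mathbf{pol}}$ and $t\in[0,T]$, $$\Big\|\hat P^i_tf-\sum_{q=0}^{\bar q-1}\frac{t^q}{q!}V_i^qf\Big\|_{k,L+\bar qL_i}\le Ct^{\bar q}\|f\|_{k+\bar qk_i,L}.$$ Then, for all $\lambda_1,\dots,\lambda_I\in[0,1]$, all $k,L\in\mathbb{N}$ and $0\le\bar q\le\nu+1$, there is $C$ such that for all $f\in\mathcal{C}^{k+\bar qk^\star,L}_{\mathbf{pol}}$ and $t\in[0,T]$, $$\Big\|\hat P^I_{\lambda_It}\cdots\hat P^1_{\lambda_1t}f-\sum_{q_1+\dots+q_I\le\bar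 q-1}\frac{\lambda_1^{q_1}\cdots\lambda_I^{q_I}t^{q_1+\dots+q_I}}{q_1!\cdots q_I!}V_I^{q_I}\cdots V_1^{q_1}f\Big\|_{k,L+\bar qL^\star}\le Ct^{\bar q}\|f\|_{k+\bar qk^\star,L}.$$
   Context: $\mathbb{R}_+=[0,\infty)$. For $k,L\in\mathbb{N}$, $\mathcal{C}^{k,L}_{\mathbf{pol}}=\mathcal{C}^{k,L}_{\mathbf{pol}}(\mathbb{R}\times\mathbb{R}_+)$ is the space of continuous functions $f:\mathbb{R}\times\mathbb{R}_+\to\mathbb{R}$ whose partial derivatives $\partial_x^\alpha\partial_y^\beta f$ exist and are continuous for all $(\alpha,\beta)\in\mathbb{N}^2$ with $\alpha+2\beta\le k$ and satisfy $|\partial_x^\alpha\partial_y^\beta f(x,y)|\le C\,\mathbf{f}_L(x,y)$ for some $C>0$, where $\mathbf{f}_L(x,y)=1+x^{2L}+y^{2L}$. It is endowed with the norm $$\|f\|_{k,L}=\sum_{\alpha+2\beta\le k}\ \sup_{(x,y)\in\mathbb{R}\times\mathbb{R}_+}\frac{|\partial_x^\alpha\partial_y^\beta f(x,y)|}{\mathbf{f}_L(x,y)}.$$ An inequality for $\|g\|_{k,L}$ includes the assertion that $g\in\mathcal{C}^{k,L}_{\mathbf{pol}}$; empty sums are $0$. *)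

theory Defs
  imports "HOL-Analysis.Analysis"
begin

text \<open>
  A real function on the closed half plane is represented by its extension by zero to the whole
  plane (see \<open>Cpol\<close> below), so that equality of functions on the half plane is HOL equality.
\<close>

type_synonym fn = "real \<times> real \<Rightarrow> real"

definition half_plane :: "(real \<times> real) set" where
  "half_plane = UNIV \<times> {0..}"

definition weight :: "nat \<Rightarrow> fn" where
  "weight L = (\<lambda>(x, y). 1 + x ^ (2 * L) + y ^ (2 * L))"

definition dx :: "fn \<Rightarrow> fn" where
  "dx f = (\<lambda>(x, y). vector_derivative (\<lambda>u. f (u, y)) (at x))"

text \<open>On the boundary \<open>y = 0\<close> the derivative in \<open>y\<close> is the right derivative.\<close>

definition dy :: "fn \<Rightarrow> fn" where
  "dy f = (\<lambda>(x, y). vector_derivative (\<lambda>v. f (x, v)) (at y within {0..}))"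

definition partial :: "nat \<Rightarrow> nat \<Rightarrow> fn \<Rightarrow> fn" where
  "partial a b f = (dx ^^ a) ((dy ^^ b) f)"

text \<open>
  As \<open>vector_derivative\<close> is total, \<open>partial a b f\<close> is meaningful only if each successive
  differentiation (\<open>b\<close> times in \<open>y\<close>, then \<open>a\<close> times in \<open>x\<close>) is applied to a differentiable function.
\<close>

definition has_partial :: "nat \<Rightarrow> nat \<Rightarrow> fn \<Rightarrow> bool" where
  "has_partial a b f \<longleftrightarrow>
     (\<forall>(x, y) \<in> half_plane.
        (\<forall>j<b. (\<lambda>v. partial 0 j f (x, v)) differentiable (at y within {0..})) \<and>
        (\<forall>i<a. (\<lambda>u. partial i b f (u, y)) differentiable (at x)))"

definition Cpol :: "nat \<Rightarrow> nat \<Rightarrow> fn set" where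
  "Cpol k L = {f. (\<forall>z. z \<notin> half_plane \<longrightarrow> f z = 0) \<and>
     (\<forall>a b. a + 2 * b \<le> k \<longrightarrow>
        has_partial a b f \<and>
        continuous_on half_plane (partial a b f) \<and>
        (\<exists>C>0. \<forall>z\<in>half_plane. \<bar>partial a b f z\<bar> \<le> C * weight L z))}"

definition pol_norm :: "nat \<Rightarrow> nat \<Rightarrow> fn \<Rightarrow> real" where
  "pol_norm k L f =
     (\<Sum>(a, b)\<in>{(a, b). a + 2 * b \<le> k}. SUP z\<in>half_plane. \<bar>partial a b f z\<bar> / weight L z)"

text \<open>To be used for linear subspaces \<open>S\<close>; function types are not instances of \<open>real_vector\<close>.\<close>

definition linear_op_on :: "fn set \<Rightarrow> (fn \<Rightarrow> fn) \<Rightarrow> bool" where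
  "linear_op_on S A \<longleftrightarrow>
     (\<forall>f\<in>S. \<forall>g\<in>S. A (\<lambda>z. f z + g z) = (\<lambda>z. A f z + A g z)) \<and>
     (\<forall>f\<in>S. \<forall>c. A (\<lambda>z. c * f z) = (\<lambda>z. c * A f z))"

text \<open>The composition \<open>A n \<circ> \<dots> \<circ> A 1\<close>, where \<open>A 1\<close> is applied first.\<close>

definition comp_upto :: "nat \<Rightarrow> (nat \<Rightarrow> fn \<Rightarrow> fn) \<Rightarrow> fn \<Rightarrow> fn" where
  "comp_upto n A = fold A [1..<Suc n]"

definition multi_indices :: "nat \<Rightarrow> nat \<Rightarrow> (nat \<Rightarrow> nat) set" where
  "multi_indices n m = {q \<in> {1..n} \<rightarrow>\<^sub>E UNIV. (\<Sum>i=1..n. q i) < m}"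

end

theory Submission
  imports Defs
begin

text \<open>
  By induction on the number \<open>n\<close> of composed operators. Let \<open>D n\<close> be the remainder of order \<open>m\<close>
  of the composition of the first \<open>n\<close> operators, and \<open>R j\<close> the remainder of order \<open>j\<close> of the
  operator \<open>P (n + 1)\<close> alone. Applying \<open>P (n + 1)\<close>, by linearity, to the expansion of the first
  \<open>n\<close> operators, and expanding the term of multi-index \<open>q\<close> only to the order \<open>m - |q|\<close> that is
  still needed, gives \<open>D (n + 1) f = P (n + 1) (D n f) + (\<Sum>q. c q * t ^ |q| * R (m - |q|) (W q f))\<close>
  with \<open>W q = V n ^^ q n \<circ> \<dots> \<circ> V 1 ^^ q 1\<close>. Every summand is of order \<open>t ^ m\<close>, at a total
  cost of \<open>m\<close> times \<open>kstar\<close> in regularity and of \<open>m\<close> times \<open>Lstar\<close> in growth.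
\<close>

section \<open>Linearity of the iterated partial derivatives on the closed half plane\<close>

lemma dy_lincomb:
  assumes z: "(x, y) \<in> half_plane"
    and h: "\<And>z. z \<in> half_plane \<Longrightarrow> h z = c * f z + d * g z"
    and f: "(\<lambda>v. f (x, v)) differentiable (at y within {0..})"
    and g: "(\<lambda>v. g (x, v)) differentiable (at y within {0..})"
  shows "(\<lambda>v. h (x, v)) differentiable (at y within {0..})"
    and "dy h (x, y) = c * dy f (x, y) + d * dy g (x, y)"
proof -
  have y: "y \<in> {0..}" using z by (simp add: half_plane_def)
  \<comment> \<open>\<open>vector_derivative\<close> picks a value, so evaluating
    \<open>dy h\<close> needs uniqueness of the one-sided derivative, that is, \<open>y\<close> must
    be a limit point of the half line. This includes \<open>y = 0\<close>.\<close>
  have nontriv: "at y within {0..} \<noteq> bot"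
  proof -
    have "y islimpt {y..y + 1}" by (rule connected_imp_perfect) auto
    then have "y islimpt {0..}" by (rule islimpt_subset) (use y in auto)
    then show ?thesis by (simp add: trivial_limit_within)
  qed
  define D where "D = c * dy f (x, y) + d * dy g (x, y)"
  have "((\<lambda>v. c * f (x, v) + d * g (x, v)) has_vector_derivative D) (at y within {0..})"
    using f g unfolding D_def dy_def split vector_derivative_works
    by (intro has_vector_derivative_add has_vector_derivative_mult_right)
  \<comment> \<open>Agreement of \<open>h\<close> with the combination on the half plane suffices:
    the derivative within \<open>{0..}\<close> never looks at negative \<open>v\<close>.\<close>
  then have D: "((\<lambda>v. h (x, v)) has_vector_derivative D) (at y within {0..})"
    using y by (rule_tac has_vector_derivative_transform[OF y _]) (auto simp: h half_plane_def)
  then show "(\<lambda>v. h (x, v)) differentiable (at y within {0..})"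
    by (rule differentiableI_vector)
  show "dy h (x, y) = c * dy f (x, y) + d * dy g (x, y)"
    using vector_derivative_within[OF nontriv D] by (simp add: D_def dy_def)
qed

text \<open>Moving in \<open>x\<close> never leaves the half plane, so \<open>h\<close> is the
  combination on a whole horizontal line and the two-sided derivative applies.\<close>

lemma dx_lincomb:
  assumes z: "(x, y) \<in> half_plane"
    and h: "\<And>z. z \<in> half_plane \<Longrightarrow> h z = c * f z + d * g z"
    and f: "(\<lambda>u. f (u, y)) differentiable (at x)"
    and g: "(\<lambda>u. g (u, y)) differentiable (at x)"
  shows "(\<lambda>u. h (u, y)) differentiable (at x)"
    and "dx h (x, y) = c * dx f (x, y) + d * dx g (x, y)"
proof -
  define D where "D = c * dx f (x, y) + d * dx g (x, y)"
  have "((\<lambda>u. c * f (u, y) + d * g (u, y)) has_vector_derivative D) (at x)"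
    using f g unfolding D_def dx_def split vector_derivative_works
    by (intro has_vector_derivative_add has_vector_derivative_mult_right)
  moreover have "(\<lambda>u. h (u, y)) = (\<lambda>u. c * f (u, y) + d * g (u, y))"
    using z h by (auto simp: half_plane_def)
  ultimately have D: "((\<lambda>u. h (u, y)) has_vector_derivative D) (at x)"
    by simp
  then show "(\<lambda>u. h (u, y)) differentiable (at x)"
    by (rule differentiableI_vector)
  show "dx h (x, y) = c * dx f (x, y) + d * dx g (x, y)"
    using vector_derivative_at[OF D] by (simp add: D_def dx_def)
qed

lemma partial_0_Suc: "partial 0 (Suc b) f = dy (partial 0 b f)"
  by (simp add: partial_def)

lemma partial_Suc: "partial (Suc a) b f = dx (partial a b f)"
  by (simp add: partial_def)

text \<open>Both recursions peel off the outermost derivative. They follow the order fixed by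
  \<open>partial\<close>, so linearity is proved by induction on \<open>b\<close> with
  \<open>a = 0\<close>, then by induction on \<open>a\<close>.\<close>

lemma has_partial_0_Suc:
  "has_partial 0 (Suc b) f \<longleftrightarrow> has_partial 0 b f \<and>
     (\<forall>(x, y) \<in> half_plane. (\<lambda>v. partial 0 b f (x, v)) differentiable (at y within {0..}))"
  unfolding has_partial_def by (auto simp: less_Suc_eq)

lemma has_partial_Suc:
  "has_partial (Suc a) b f \<longleftrightarrow> has_partial a b f \<and>
     (\<forall>(x, y) \<in> half_plane. (\<lambda>u. partial a b f (u, y)) differentiable (at x))"
  unfolding has_partial_def by (auto simp: less_Suc_eq)

text \<open>Existence and value are proved together: differentiating once more uses the identity for
  the previous order, which is available on the half plane only.\<close>

lemma partial_lincomb_0: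
  assumes "has_partial 0 b f" "has_partial 0 b g"
  shows "has_partial 0 b (\<lambda>z. c * f z + d * g z) \<and>
    (\<forall>z\<in>half_plane. partial 0 b (\<lambda>z. c * f z + d * g z) z = c * partial 0 b f z + d * partial 0 b g z)"
  using assms
proof (induction b)
  case 0
  then show ?case by (simp add: has_partial_def partial_def)
next
  case (Suc b)
  let ?h = "\<lambda>z. c * f z + d * g z"
  have IH: "has_partial 0 b ?h"
    "\<And>z. z \<in> half_plane \<Longrightarrow> partial 0 b ?h z = c * partial 0 b f z + d * partial 0 b g z"
    using Suc by (auto simp: has_partial_0_Suc)
  note step = dy_lincomb[where h = "partial 0 b ?h" and f = "partial 0 b f" and g = "partial 0 b g"
      and c = c and d = d, OF _ IH(2)]
  show ?case
    using IH(1) Suc.prems step by (fastforce simp: has_partial_0_Suc partial_0_Suc)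
qed

lemma partial_lincomb:
  assumes "has_partial a b f" "has_partial a b g"
  shows "has_partial a b (\<lambda>z. c * f z + d * g z) \<and>
    (\<forall>z\<in>half_plane. partial a b (\<lambda>z. c * f z + d * g z) z = c * partial a b f z + d * partial a b g z)"
  using assms
proof (induction a)
  case 0
  then show ?case by (rule partial_lincomb_0)
next
  case (Suc a)
  let ?h = "\<lambda>z. c * f z + d * g z"
  have IH: "has_partial a b ?h"
    "\<And>z. z \<in> half_plane \<Longrightarrow> partial a b ?h z = c * partial a b f z + d * partial a b g z"
    using Suc by (auto simp: has_partial_Suc)
  note step = dx_lincomb[where h = "partial a b ?h" and f = "partial a b f" and g = "partial a b g"
      and c = c and d = d, OF _ IH(2)]
  show ?case
    using IH(1) Suc.prems step by (fastforce simp: has_partial_Suc partial_Suc)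
qed

section \<open>Weights and weighted suprema\<close>

lemma weight_ge_1: "weight L z \<ge> 1"
  by (cases z) (simp add: weight_def power_mult)

lemma weight_pos: "weight L z > 0"
  using weight_ge_1[of L z] by linarith

text \<open>Comparing \<open>u\<^sup>2\<close> with 1 bounds the lower power by 1 plus the higher
  one. The constant 1 and one further 1 from each coordinate make up the factor 3.\<close>

lemma weight_mono:
  assumes "L \<le> L'"
  shows "weight L z \<le> 3 * weight L' z"
proof -
  have pow: "(u::real) ^ (2 * L) \<le> 1 + u ^ (2 * L')" for u
  proof (cases "u\<^sup>2 \<le> 1")
    case True
    then have "(u\<^sup>2) ^ L \<le> 1" by (simp add: power_le_one)
    moreover have "(u\<^sup>2) ^ L' \<ge> 0" by simp
    ultimately show ?thesis unfolding power_mult by linarith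
  next
    case False
    then have "(u\<^sup>2) ^ L \<le> (u\<^sup>2) ^ L'" using assms by (intro power_increasing) auto
    then show ?thesis unfolding power_mult by linarith
  qed
  obtain x y where z: "z = (x, y)" by (cases z)
  have "1 + a + b \<le> 3 * (1 + a' + b')"
    if "a \<le> 1 + a'" "b \<le> 1 + b'" "0 \<le> a'" "0 \<le> b'" for a b a' b' :: real
    using that by (simp add: algebra_simps)
  from this[OF pow[of x] pow[of y]] show ?thesis by (simp add: z weight_def)
qed

lemma half_plane_nonempty: "half_plane \<noteq> {}"
  by (auto simp: half_plane_def)

text \<open>A real supremum is an upper bound only for a set bounded above. The growth bound in
  \<open>Cpol\<close> ensures this, and the supremum then serves as the constant of that
  bound.\<close>

lemma partial_le_weighted_sup:
  assumes "f \<in> Cpol k L" "a + 2 * b \<le> k" "z \<in> half_plane"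
  shows "\<bar>partial a b f z\<bar> \<le> (SUP z\<in>half_plane. \<bar>partial a b f z\<bar> / weight L z) * weight L z"
proof -
  obtain C where C: "\<And>z. z \<in> half_plane \<Longrightarrow> \<bar>partial a b f z\<bar> \<le> C * weight L z"
    using assms(1,2) unfolding Cpol_def by blast
  have "bdd_above ((\<lambda>z. \<bar>partial a b f z\<bar> / weight L z) ` half_plane)"
    using C weight_pos by (intro bdd_aboveI2[where M = C]) (simp add: divide_le_eq)
  then have "\<bar>partial a b f z\<bar> / weight L z \<le> (SUP z\<in>half_plane. \<bar>partial a b f z\<bar> / weight L z)"
    using assms(3) by (intro cSUP_upper)
  then show ?thesis by (simp add: divide_le_eq weight_pos)
qed

lemma weighted_sup_le:
  assumes "\<And>z. z \<in> half_plane \<Longrightarrow> \<bar>F z\<bar> \<le> M * weight L z"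
  shows "(SUP z\<in>half_plane. \<bar>F z\<bar> / weight L z) \<le> M"
  using assms weight_pos by (intro cSUP_least half_plane_nonempty) (simp add: divide_le_eq)

lemma weighted_sup_nonneg:
  assumes "f \<in> Cpol k L" "a + 2 * b \<le> k"
  shows "(SUP z\<in>half_plane. \<bar>partial a b f z\<bar> / weight L z) \<ge> 0"
proof -
  have "(0, 0) \<in> half_plane" by (simp add: half_plane_def)
  from partial_le_weighted_sup[OF assms this]
  have "0 \<le> (SUP z\<in>half_plane. \<bar>partial a b f z\<bar> / weight L z) * weight L (0, 0)"
    by linarith
  then show ?thesis
    using weight_pos[of L "(0, 0)"] by (simp add: zero_le_mult_iff)
qed

lemma finite_partial_orders: "finite {(a, b). a + 2 * b \<le> (k::nat)}"
  by (rule finite_subset[of _ "{..k} \<times> {..k}"]) auto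

lemma pol_norm_nonneg: "f \<in> Cpol k L \<Longrightarrow> pol_norm k L f \<ge> 0"
  unfolding pol_norm_def by (intro sum_nonneg) (auto intro: weighted_sup_nonneg)

section \<open>Linear structure and embeddings of the spaces \<open>Cpol k L\<close>\<close>

lemma Cpol_lincomb:
  assumes f: "f \<in> Cpol k L" and g: "g \<in> Cpol k L"
  shows "(\<lambda>z. c * f z + d * g z) \<in> Cpol k L"
    and "pol_norm k L (\<lambda>z. c * f z + d * g z) \<le> \<bar>c\<bar> * pol_norm k L f + \<bar>d\<bar> * pol_norm k L g"
proof -
  let ?h = "\<lambda>z. c * f z + d * g z"
  define S where "S a b f = (SUP z\<in>half_plane. \<bar>partial a b f z\<bar> / weight L z)" for a b f
  have part: "has_partial a b ?h"
    "\<And>z. z \<in> half_plane \<Longrightarrow> partial a b ?h z = c * partial a b f z + d * partial a b g z"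
    if "a + 2 * b \<le> k" for a b
    using partial_lincomb[of a b f g c d] f g that by (auto simp: Cpol_def)
  have bound: "\<bar>partial a b ?h z\<bar> \<le> (\<bar>c\<bar> * S a b f + \<bar>d\<bar> * S a b g) * weight L z"
    if ab: "a + 2 * b \<le> k" and z: "z \<in> half_plane" for a b z
  proof -
    have "\<bar>partial a b ?h z\<bar> \<le> \<bar>c\<bar> * \<bar>partial a b f z\<bar> + \<bar>d\<bar> * \<bar>partial a b g z\<bar>"
      unfolding part(2)[OF ab z] by (metis abs_mult abs_triangle_ineq)
    also have "\<dots> \<le> \<bar>c\<bar> * (S a b f * weight L z) + \<bar>d\<bar> * (S a b g * weight L z)"
      unfolding S_def by (intro add_mono mult_left_mono partial_le_weighted_sup[OF f ab z]
          partial_le_weighted_sup[OF g ab z]) auto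
    finally show ?thesis by (simp add: algebra_simps)
  qed
  have "continuous_on half_plane (partial a b ?h)" if ab: "a + 2 * b \<le> k" for a b
  proof -
    have "continuous_on half_plane (\<lambda>z. c * partial a b f z + d * partial a b g z)"
      using f g ab by (intro continuous_intros) (auto simp: Cpol_def)
    then show ?thesis
      by (subst continuous_on_cong[OF refl part(2)[OF ab]])
  qed
  moreover have "\<exists>C>0. \<forall>z\<in>half_plane. \<bar>partial a b ?h z\<bar> \<le> C * weight L z"
    if ab: "a + 2 * b \<le> k" for a b
  \<comment> \<open>\<open>Cpol\<close> asks for a strictly positive constant; the added 1 covers
    the case where both suprema vanish.\<close>
  proof (intro exI[of _ "\<bar>\<bar>c\<bar> * S a b f + \<bar>d\<bar> * S a b g\<bar> + 1"] conjI ballI)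
    fix z assume z: "z \<in> half_plane"
    have "(\<bar>c\<bar> * S a b f + \<bar>d\<bar> * S a b g) * weight L z
        \<le> (\<bar>\<bar>c\<bar> * S a b f + \<bar>d\<bar> * S a b g\<bar> + 1) * weight L z"
      by (intro mult_right_mono) (use weight_pos[of L z] in auto)
    then show "\<bar>partial a b ?h z\<bar> \<le> (\<bar>\<bar>c\<bar> * S a b f + \<bar>d\<bar> * S a b g\<bar> + 1) * weight L z"
      using bound[OF ab z] by linarith
  qed auto
  ultimately show "?h \<in> Cpol k L"
    using f g part(1) unfolding Cpol_def by auto
  have "pol_norm k L ?h \<le> (\<Sum>(a, b)\<in>{(a, b). a + 2 * b \<le> k}. \<bar>c\<bar> * S a b f + \<bar>d\<bar> * S a b g)"
    unfolding pol_norm_def by (intro sum_mono) (auto intro!: weighted_sup_le bound)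
  also have "\<dots> = \<bar>c\<bar> * pol_norm k L f + \<bar>d\<bar> * pol_norm k L g"
    by (simp add: pol_norm_def S_def case_prod_unfold sum.distrib sum_distrib_left)
  finally show "pol_norm k L ?h \<le> \<bar>c\<bar> * pol_norm k L f + \<bar>d\<bar> * pol_norm k L g" .
qed

lemma Cpol_scale:
  assumes "f \<in> Cpol k L"
  shows "(\<lambda>z. c * f z) \<in> Cpol k L" "pol_norm k L (\<lambda>z. c * f z) \<le> \<bar>c\<bar> * pol_norm k L f"
  using Cpol_lincomb[OF assms assms, of c 0] by simp_all

lemma Cpol_add:
  assumes "f \<in> Cpol k L" "g \<in> Cpol k L"
  shows "(\<lambda>z. f z + g z) \<in> Cpol k L"
    "pol_norm k L (\<lambda>z. f z + g z) \<le> pol_norm k L f + pol_norm k L g"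
  using Cpol_lincomb[OF assms, of 1 1] by simp_all

text \<open>The distinguished summand \<open>g\<close> starts the induction and later becomes the
  remainder of the first \<open>n\<close> operators. \<open>linear_op_on_sum\<close> has the same
  shape.\<close>

lemma Cpol_sum:
  assumes "finite Q" "g \<in> Cpol k L" "\<And>q. q \<in> Q \<Longrightarrow> w q \<in> Cpol k L"
  shows "(\<lambda>z. g z + (\<Sum>q\<in>Q. c q * w q z)) \<in> Cpol k L"
  using assms
proof (induction Q rule: finite_induct)
  case (insert q Q)
  then have "(\<lambda>z. c q * w q z + (g z + (\<Sum>q\<in>Q. c q * w q z))) \<in> Cpol k L"
    by (intro Cpol_add(1)[of "\<lambda>z. c q * w q z"] Cpol_scale(1)) auto
  then show ?case using insert.hyps by (simp add: ac_simps)
qed simp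

text \<open>Less regularity drops nonnegative terms from the norm, and a larger weight costs the
  factor 3 of \<open>weight_mono\<close>. This embedding lets every loss be replaced by a larger
  common one.\<close>

lemma Cpol_mono:
  assumes f: "f \<in> Cpol k' L" and kL: "k \<le> k'" "L \<le> L'"
  shows "f \<in> Cpol k L'" "pol_norm k L' f \<le> 3 * pol_norm k' L f"
proof -
  define S where "S a b = (SUP z\<in>half_plane. \<bar>partial a b f z\<bar> / weight L z)" for a b
  have S_nonneg: "S a b \<ge> 0" if "a + 2 * b \<le> k'" for a b
    unfolding S_def by (rule weighted_sup_nonneg[OF f that])
  have bound: "\<bar>partial a b f z\<bar> \<le> 3 * S a b * weight L' z"
    if ab: "a + 2 * b \<le> k'" and z: "z \<in> half_plane" for a b z
  proof -
    have "\<bar>partial a b f z\<bar> \<le> S a b * weight L z"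
      unfolding S_def by (rule partial_le_weighted_sup[OF f ab z])
    also have "\<dots> \<le> S a b * (3 * weight L' z)"
      by (intro mult_left_mono weight_mono kL S_nonneg[OF ab])
    finally show ?thesis by simp
  qed
  have "\<exists>C>0. \<forall>z\<in>half_plane. \<bar>partial a b f z\<bar> \<le> C * weight L' z" if "a + 2 * b \<le> k" for a b
  proof (intro exI[of _ "3 * S a b + 1"] conjI ballI)
    have ab: "a + 2 * b \<le> k'" using that kL by simp
    show "3 * S a b + 1 > 0" using S_nonneg[OF ab] by simp
    fix z assume z: "z \<in> half_plane"
    show "\<bar>partial a b f z\<bar> \<le> (3 * S a b + 1) * weight L' z"
      using bound[OF ab z] weight_pos[of L' z] by (simp add: distrib_right)
  qed
  then show "f \<in> Cpol k L'"
    using f kL by (auto simp: Cpol_def)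
  have "pol_norm k L' f \<le> (\<Sum>(a, b)\<in>{(a, b). a + 2 * b \<le> k}. 3 * S a b)"
    unfolding pol_norm_def using kL by (intro sum_mono) (auto intro!: weighted_sup_le bound)
  also have "\<dots> \<le> (\<Sum>(a, b)\<in>{(a, b). a + 2 * b \<le> k'}. 3 * S a b)"
    using kL by (intro sum_mono2 finite_partial_orders) (auto intro: S_nonneg)
  also have "\<dots> = 3 * pol_norm k' L f"
    by (simp add: pol_norm_def S_def case_prod_unfold sum_distrib_left)
  finally show "pol_norm k L' f \<le> 3 * pol_norm k' L f" .
qed

section \<open>Linear operators on finite combinations, and operator families of order
  \<open>t ^ m\<close>\<close>

lemma linear_op_on_sum:
  assumes A: "linear_op_on (Cpol k L) A" and "finite Q"
    and "g \<in> Cpol k L" "\<And>q. q \<in> Q \<Longrightarrow> w q \<in> Cpol k L"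
  shows "A (\<lambda>z. g z + (\<Sum>q\<in>Q. c q * w q z)) = (\<lambda>z. A g z + (\<Sum>q\<in>Q. c q * A (w q) z))"
  using assms(2-)
proof (induction Q rule: finite_induct)
  case (insert q Q)
  let ?s = "\<lambda>z. g z + (\<Sum>q\<in>Q. c q * w q z)"
  have mem: "?s \<in> Cpol k L" "w q \<in> Cpol k L" "(\<lambda>z. c q * w q z) \<in> Cpol k L"
    using insert by (auto intro!: Cpol_sum Cpol_scale)
  have "A (\<lambda>z. c q * w q z + ?s z) = (\<lambda>z. c q * A (w q) z + A ?s z)"
    using A mem by (simp add: linear_op_on_def)
  also have "A ?s = (\<lambda>z. A g z + (\<Sum>q\<in>Q. c q * A (w q) z))"
    using insert by simp
  finally show ?case
    using insert.hyps by (simp add: ac_simps)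
qed simp

text \<open>All estimates take this form, with a constant uniform in \<open>f\<close> and
  \<open>t\<close>; the proof then only combines closure properties of the predicate.
  \<open>C \<ge> 0\<close> allows estimates to be chained.\<close>

definition bounded_family ::
    "real \<Rightarrow> nat \<Rightarrow> nat \<Rightarrow> nat \<Rightarrow> nat \<Rightarrow> nat \<Rightarrow> (real \<Rightarrow> fn \<Rightarrow> fn) \<Rightarrow> bool" where
  "bounded_family T m k L k' L' A \<longleftrightarrow>
     (\<exists>C\<ge>0. \<forall>f\<in>Cpol k L. \<forall>t\<in>{0..T}.
        A t f \<in> Cpol k' L' \<and> pol_norm k' L' (A t f) \<le> C * t ^ m * pol_norm k L f)"

text \<open>A constant of unknown sign may be supplied: both \<open>t ^ m\<close> and the norm are
  nonnegative, so its absolute value also works.\<close>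

lemma bounded_familyI:
  assumes "\<And>f t. f \<in> Cpol k L \<Longrightarrow> 0 \<le> t \<Longrightarrow> t \<le> T \<Longrightarrow> A t f \<in> Cpol k' L'"
    and "\<And>f t. f \<in> Cpol k L \<Longrightarrow> 0 \<le> t \<Longrightarrow> t \<le> T \<Longrightarrow>
      pol_norm k' L' (A t f) \<le> C * t ^ m * pol_norm k L f"
  shows "bounded_family T m k L k' L' A"
  unfolding bounded_family_def
proof (intro exI[of _ "\<bar>C\<bar>"] conjI ballI)
  fix f t assume f: "f \<in> Cpol k L" and t: "t \<in> {0..T}"
  show "A t f \<in> Cpol k' L'" using assms(1) f t by simp
  have "pol_norm k' L' (A t f) \<le> C * t ^ m * pol_norm k L f" using assms(2) f t by simp
  also have "\<dots> \<le> \<bar>C\<bar> * t ^ m * pol_norm k L f"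
    using t pol_norm_nonneg[OF f] by (intro mult_right_mono) auto
  finally show "pol_norm k' L' (A t f) \<le> \<bar>C\<bar> * t ^ m * pol_norm k L f" .
qed simp

lemma bounded_familyE:
  assumes "bounded_family T m k L k' L' A"
  obtains C where "C \<ge> 0"
    and "\<And>f t. f \<in> Cpol k L \<Longrightarrow> 0 \<le> t \<Longrightarrow> t \<le> T \<Longrightarrow> A t f \<in> Cpol k' L'"
    and "\<And>f t. f \<in> Cpol k L \<Longrightarrow> 0 \<le> t \<Longrightarrow> t \<le> T \<Longrightarrow>
      pol_norm k' L' (A t f) \<le> C * t ^ m * pol_norm k L f"
  using assms unfolding bounded_family_def by auto

lemma bounded_family_mem:
  assumes "bounded_family T m k L k' L' A" "f \<in> Cpol k L" "0 \<le> t" "t \<le> T"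
  shows "A t f \<in> Cpol k' L'"
  using assms by (auto elim: bounded_familyE)

lemma bounded_family_cong:
  assumes "bounded_family T m k L k' L' A"
    and "\<And>f t. f \<in> Cpol k L \<Longrightarrow> 0 \<le> t \<Longrightarrow> t \<le> T \<Longrightarrow> A t f = B t f"
  shows "bounded_family T m k L k' L' B"
  using assms unfolding bounded_family_def by auto

lemma bounded_family_id: "bounded_family T 0 k L k L (\<lambda>t f. f)"
  by (rule bounded_familyI[where C = 1]) simp_all

lemma bounded_family_zero:
  assumes "k' \<le> k" "L \<le> L'"
  shows "bounded_family T m k L k' L' (\<lambda>t f z. 0)"
proof (rule bounded_familyI[where C = 0])
  fix f t assume "f \<in> Cpol k L"
  then have "f \<in> Cpol k' L'" using assms by (rule Cpol_mono)
  from Cpol_scale[OF this, of 0]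
  show "(\<lambda>z. 0) \<in> Cpol k' L'" "pol_norm k' L' (\<lambda>z. 0) \<le> 0 * t ^ m * pol_norm k L f"
    by simp_all
qed

text \<open>Inserting the estimate for \<open>A\<close> into the one for \<open>B\<close> multiplies
  the constants and adds the powers of \<open>t\<close>. This is how orders in time
  accumulate.\<close>

lemma bounded_family_compose:
  assumes A: "bounded_family T m k1 L1 k2 L2 A" and B: "bounded_family T n k2 L2 k3 L3 B"
  shows "bounded_family T (m + n) k1 L1 k3 L3 (\<lambda>t f. B t (A t f))"
proof -
  obtain a where a: "\<And>f t. f \<in> Cpol k1 L1 \<Longrightarrow> 0 \<le> t \<Longrightarrow> t \<le> T \<Longrightarrow>
      pol_norm k2 L2 (A t f) \<le> a * t ^ m * pol_norm k1 L1 f"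
    using A by (elim bounded_familyE) blast
  obtain b where b: "b \<ge> 0" "\<And>f t. f \<in> Cpol k2 L2 \<Longrightarrow> 0 \<le> t \<Longrightarrow> t \<le> T \<Longrightarrow>
      pol_norm k3 L3 (B t f) \<le> b * t ^ n * pol_norm k2 L2 f"
    using B by (elim bounded_familyE) blast
  show ?thesis
  proof (rule bounded_familyI[where C = "a * b"])
    fix f t assume f: "f \<in> Cpol k1 L1" and t: "0 \<le> t" "t \<le> T"
    have Af: "A t f \<in> Cpol k2 L2" by (rule bounded_family_mem[OF A f t])
    show "B t (A t f) \<in> Cpol k3 L3" by (rule bounded_family_mem[OF B Af t])
    have "pol_norm k3 L3 (B t (A t f)) \<le> b * t ^ n * pol_norm k2 L2 (A t f)"
      by (rule b(2)[OF Af t])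
    also have "\<dots> \<le> b * t ^ n * (a * t ^ m * pol_norm k1 L1 f)"
      using a[OF f t] b(1) t by (intro mult_left_mono) auto
    finally show "pol_norm k3 L3 (B t (A t f)) \<le> a * b * t ^ (m + n) * pol_norm k1 L1 f"
      by (simp add: power_add ac_simps)
  qed
qed

text \<open>The identity between nested spaces is a family of order 0 by \<open>Cpol_mono\<close>;
  composing with it on both sides changes the source and the target.\<close>

lemma bounded_family_weaken:
  assumes "bounded_family T m k L k' L' A" "k \<le> k2" "L2 \<le> L" "k2' \<le> k'" "L' \<le> L2'"
  shows "bounded_family T m k2 L2 k2' L2' A"
proof -
  have emb: "bounded_family T 0 a b a' b' (\<lambda>t f. f)" if "a' \<le> a" "b \<le> b'" for a a' b b'
    using that by (intro bounded_familyI[where C = 3]) (auto intro: Cpol_mono)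
  have "bounded_family T (0 + m) k2 L2 k' L' A"
    using bounded_family_compose[OF emb[OF assms(2,3)] assms(1)] by simp
  from bounded_family_compose[OF this emb[OF assms(4,5)]] show ?thesis by simp
qed

text \<open>For \<open>l\<close> in the unit interval the time \<open>l * t\<close> stays in the
  admissible range and \<open>(l * t) ^ m \<le> t ^ m\<close>, so even the constant is
  preserved.\<close>

lemma bounded_family_rescale:
  assumes "bounded_family T m k L k' L' A" and l: "0 \<le> l" "l \<le> 1"
  shows "bounded_family T m k L k' L' (\<lambda>t. A (l * t))"
proof -
  obtain C where C: "C \<ge> 0" "\<And>f t. f \<in> Cpol k L \<Longrightarrow> 0 \<le> t \<Longrightarrow> t \<le> T \<Longrightarrow>
      pol_norm k' L' (A t f) \<le> C * t ^ m * pol_norm k L f"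
    using assms(1) by (elim bounded_familyE) blast
  show ?thesis
  proof (rule bounded_familyI[where C = C])
    fix f t assume f: "f \<in> Cpol k L" and t: "0 \<le> t" "t \<le> T"
    have lt: "0 \<le> l * t" "l * t \<le> t" using l t by (auto intro: mult_left_le_one_le)
    then have le_T: "l * t \<le> T" using t by linarith
    show "A (l * t) f \<in> Cpol k' L'" by (rule bounded_family_mem[OF assms(1) f lt(1) le_T])
    have "pol_norm k' L' (A (l * t) f) \<le> C * (l * t) ^ m * pol_norm k L f"
      by (rule C(2)[OF f lt(1) le_T])
    also have "\<dots> \<le> C * t ^ m * pol_norm k L f"
      using C(1) lt pol_norm_nonneg[OF f] by (intro mult_right_mono mult_left_mono power_mono)
    finally show "pol_norm k' L' (A (l * t) f) \<le> C * t ^ m * pol_norm k L f" .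
  qed
qed

text \<open>Multiplication by \<open>c * t ^ j\<close> is itself a family of order \<open>j\<close>
  on the target space, so this is an instance of composition.\<close>

lemma bounded_family_scale:
  assumes "bounded_family T m k L k' L' A"
  shows "bounded_family T (j + m) k L k' L' (\<lambda>t f z. c * t ^ j * A t f z)"
proof -
  have "bounded_family T j k' L' k' L' (\<lambda>t f z. c * t ^ j * f z)"
  proof (rule bounded_familyI[where C = "\<bar>c\<bar>"])
    fix f and t :: real assume "f \<in> Cpol k' L'" "0 \<le> t"
    then show "(\<lambda>z. c * t ^ j * f z) \<in> Cpol k' L'"
      "pol_norm k' L' (\<lambda>z. c * t ^ j * f z) \<le> \<bar>c\<bar> * t ^ j * pol_norm k' L' f"
      using Cpol_scale[of f k' L' "c * t ^ j"] by (simp_all add: abs_mult)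
  qed
  from bounded_family_compose[OF assms this] show ?thesis by (simp add: add.commute)
qed

lemma bounded_family_add:
  assumes A: "bounded_family T m k L k' L' A" and B: "bounded_family T m k L k' L' B"
  shows "bounded_family T m k L k' L' (\<lambda>t f z. A t f z + B t f z)"
proof -
  obtain a where a: "\<And>f t. f \<in> Cpol k L \<Longrightarrow> 0 \<le> t \<Longrightarrow> t \<le> T \<Longrightarrow>
      pol_norm k' L' (A t f) \<le> a * t ^ m * pol_norm k L f"
    using A by (elim bounded_familyE) blast
  obtain b where b: "\<And>f t. f \<in> Cpol k L \<Longrightarrow> 0 \<le> t \<Longrightarrow> t \<le> T \<Longrightarrow>
      pol_norm k' L' (B t f) \<le> b * t ^ m * pol_norm k L f"
    using B by (elim bounded_familyE) blast
  show ?thesis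
  proof (rule bounded_familyI[where C = "a + b"])
    fix f t assume f: "f \<in> Cpol k L" and t: "0 \<le> t" "t \<le> T"
    note sum = Cpol_add[OF bounded_family_mem[OF A f t] bounded_family_mem[OF B f t]]
    show "(\<lambda>z. A t f z + B t f z) \<in> Cpol k' L'" by (rule sum)
    show "pol_norm k' L' (\<lambda>z. A t f z + B t f z) \<le> (a + b) * t ^ m * pol_norm k L f"
      using sum(2) a[OF f t] b[OF f t] by (simp add: distrib_right)
  qed
qed

lemma bounded_family_add_sum:
  assumes "finite Q" "bounded_family T m k L k' L' A"
    and "\<And>q. q \<in> Q \<Longrightarrow> bounded_family T m k L k' L' (B q)"
  shows "bounded_family T m k L k' L' (\<lambda>t f z. A t f z + (\<Sum>q\<in>Q. B q t f z))"
  using assms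
proof (induction Q rule: finite_induct)
  case (insert q Q)
  then have "bounded_family T m k L k' L' (\<lambda>t f z. B q t f z + (A t f z + (\<Sum>q\<in>Q. B q t f z)))"
    by (intro bounded_family_add[where A = "B q"]) auto
  then show ?case using insert.hyps by (simp add: ac_simps)
qed simp

section \<open>Ordered compositions and sums over multi-indices\<close>

lemma comp_upto_0: "comp_upto 0 A f = f"
  by (simp add: comp_upto_def)

lemma comp_upto_Suc: "comp_upto (Suc n) A f = A (Suc n) (comp_upto n A f)"
  by (simp add: comp_upto_def)

lemma comp_upto_cong:
  assumes "\<And>i. i \<in> {1..n} \<Longrightarrow> A i = B i"
  shows "comp_upto n A f = comp_upto n B f"
  unfolding comp_upto_def by (rule fold_cong) (use assms in auto)

lemma finite_multi_indices: "finite (multi_indices n m)"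
proof (rule finite_subset)
  show "multi_indices n m \<subseteq> {1..n} \<rightarrow>\<^sub>E {..<m}"
  proof
    fix q assume q: "q \<in> multi_indices n m"
    have "q i < m" if "i \<in> {1..n}" for i
    proof -
      have "q i \<le> (\<Sum>i=1..n. q i)" by (rule member_le_sum[OF that]) auto
      then show ?thesis using q by (simp add: multi_indices_def)
    qed
    then show "q \<in> {1..n} \<rightarrow>\<^sub>E {..<m}" using q by (auto simp: multi_indices_def PiE_iff)
  qed
qed (intro finite_PiE, auto)

lemma sum_fun_upd_Suc: "(\<Sum>i=1..n. (q(Suc n := r)) i) = (\<Sum>i=1..n. q i :: nat)"
  by (rule sum.cong) auto

text \<open>Splitting off the last entry \<open>r\<close> leaves a multi-index of length
  \<open>n\<close> and the budget \<open>r < m - |q|\<close>. Restriction and update are mutually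
  inverse because multi-indices are extensional.\<close>

lemma sum_multi_indices_Suc:
  fixes F :: "(nat \<Rightarrow> nat) \<Rightarrow> real"
  shows "(\<Sum>q\<in>multi_indices (Suc n) m. F q) =
    (\<Sum>q\<in>multi_indices n m. \<Sum>r<m - (\<Sum>i=1..n. q i). F (q(Suc n := r)))"
proof -
  have upd: "(restrict q {1..n})(Suc n := q (Suc n)) = q" if "q \<in> multi_indices (Suc n) m" for q
    using that by (auto simp: fun_eq_iff multi_indices_def PiE_iff extensional_def)
  have restr: "restrict (q(Suc n := r)) {1..n} = q" if "q \<in> multi_indices n m" for q r
    using that by (auto simp: fun_eq_iff multi_indices_def PiE_iff extensional_def)
  have "(\<Sum>q\<in>multi_indices n m. \<Sum>r<m - (\<Sum>i=1..n. q i). F (q(Suc n := r))) =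
      (\<Sum>(q, r)\<in>(SIGMA q:multi_indices n m. {..<m - (\<Sum>i=1..n. q i)}). F (q(Suc n := r)))"
    by (rule sum.Sigma) (auto simp: finite_multi_indices)
  also have "\<dots> = (\<Sum>q\<in>multi_indices (Suc n) m. F q)"
  proof (rule sum.reindex_bij_witness[where j = "\<lambda>(q, r). q(Suc n := r)"
        and i = "\<lambda>q. (restrict q {1..n}, q (Suc n))"], goal_cases)
    case (1 a) then show ?case using restr by (auto split: prod.splits)
  next
    case (2 a) then show ?case
      by (auto simp: multi_indices_def PiE_iff extensional_def sum_fun_upd_Suc split: prod.splits)
  next
    case (3 q) then show ?case using upd by auto
  next
    case (4 q) then show ?case
      by (auto simp: multi_indices_def)
  qed (auto split: prod.splits)
  finally show ?thesis by simp
qed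

section \<open>Expansion of the composition, with losses \<open>K\<close> and
  \<open>\<Lambda>\<close> common to all operators\<close>

locale expansion =
  fixes \<nu> I :: nat and T :: real
    and V :: "nat \<Rightarrow> fn \<Rightarrow> fn"
    and P :: "nat \<Rightarrow> real \<Rightarrow> fn \<Rightarrow> fn"
    and K \<Lambda> :: nat
    and l :: "nat \<Rightarrow> real"
  assumes V_bounded: "i \<in> {1..I} \<Longrightarrow> bounded_family T 0 (k + K) L k (L + \<Lambda>) (\<lambda>t. V i)"
    and P_linear: "i \<in> {1..I} \<Longrightarrow> 0 \<le> t \<Longrightarrow> t \<le> T \<Longrightarrow> linear_op_on (Cpol 0 L) (P i t)"
    and P_bounded: "i \<in> {1..I} \<Longrightarrow> m \<le> \<nu> + 1 \<Longrightarrow>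
      bounded_family T m (k + m * K) L k (L + m * \<Lambda>)
        (\<lambda>t f z. P i t f z - (\<Sum>q<m. t ^ q / fact q * (V i ^^ q) f z))"
    and l: "i \<in> {1..I} \<Longrightarrow> 0 \<le> l i" "i \<in> {1..I} \<Longrightarrow> l i \<le> 1"
begin

text \<open>The power of \<open>t\<close> is kept outside, so that \<open>coeff n q\<close> can be
  the time-independent scalar in \<open>bounded_family_scale\<close>.\<close>

definition coeff :: "nat \<Rightarrow> (nat \<Rightarrow> nat) \<Rightarrow> real" where
  "coeff n q = (\<Prod>i=1..n. l i ^ q i) / (\<Prod>i=1..n. fact (q i))"

definition iterated :: "nat \<Rightarrow> (nat \<Rightarrow> nat) \<Rightarrow> fn \<Rightarrow> fn" where
  "iterated n q = comp_upto n (\<lambda>i. V i ^^ q i)"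

definition single_remainder :: "nat \<Rightarrow> nat \<Rightarrow> real \<Rightarrow> fn \<Rightarrow> fn" where
  "single_remainder i m t f = (\<lambda>z. P i t f z - (\<Sum>r<m. t ^ r / fact r * (V i ^^ r) f z))"

definition remainder :: "nat \<Rightarrow> nat \<Rightarrow> real \<Rightarrow> fn \<Rightarrow> fn" where
  "remainder n m t f = (\<lambda>z. comp_upto n (\<lambda>i. P i (l i * t)) f z -
     (\<Sum>q\<in>multi_indices n m. coeff n q * t ^ (\<Sum>i=1..n. q i) * iterated n q f z))"

lemma V_power_bounded:
  assumes i: "i \<in> {1..I}"
  shows "bounded_family T 0 (k + j * K) L k (L + j * \<Lambda>) (\<lambda>t. V i ^^ j)"
proof (induction j arbitrary: k)
  case 0
  show ?case using bounded_family_id by simp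
next
  case (Suc j)
  from bounded_family_compose[OF Suc[of "k + K"] V_bounded[OF i]]
  show ?case by (simp add: ac_simps)
qed

text \<open>With common losses the cost depends on \<open>q\<close> only through its sum. The
  induction varies \<open>k\<close>, since the first \<open>n\<close> factors must land in a space
  regular enough for the powers of \<open>V (Suc n)\<close>.\<close>

lemma iterated_bounded:
  assumes "n \<le> I"
  shows "bounded_family T 0 (k + (\<Sum>i=1..n. q i) * K) L k (L + (\<Sum>i=1..n. q i) * \<Lambda>)
    (\<lambda>t. iterated n q)"
  using assms
proof (induction n arbitrary: k)
  case 0
  show ?case using bounded_family_id by (simp add: iterated_def comp_upto_0)
next
  case (Suc n)
  have "bounded_family T 0 (k + q (Suc n) * K + (\<Sum>i=1..n. q i) * K) L
      (k + q (Suc n) * K) (L + (\<Sum>i=1..n. q i) * \<Lambda>) (\<lambda>t. iterated n q)"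
    using Suc by simp
  from bounded_family_compose[OF this V_power_bounded[of "Suc n"]] Suc.prems
  show ?case by (simp add: iterated_def comp_upto_Suc algebra_simps)
qed

text \<open>Linearity of \<open>P\<close> is available on each space \<open>Cpol 0 L\<close>, so the
  remainder and all iterated terms are required to lie in a common one.\<close>

lemma remainder_Suc:
  assumes n: "Suc n \<le> I" and t: "0 \<le> t" "t \<le> T"
    and rem: "remainder n m t f \<in> Cpol 0 L"
    and iter: "\<And>q. q \<in> multi_indices n m \<Longrightarrow> iterated n q f \<in> Cpol 0 L"
  shows "remainder (Suc n) m t f = (\<lambda>z. P (Suc n) (l (Suc n) * t) (remainder n m t f) z +
    (\<Sum>q\<in>multi_indices n m. coeff n q * t ^ (\<Sum>i=1..n. q i) *
       single_remainder (Suc n) (m - (\<Sum>i=1..n. q i)) (l (Suc n) * t) (iterated n q f) z))"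
proof
  fix z
  define s where "s = l (Suc n) * t"
  define c where "c q = coeff n q * t ^ (\<Sum>i=1..n. q i)" for q
  let ?M = "multi_indices n m" and ?P = "P (Suc n) s"
  have "s \<le> t" unfolding s_def using l[of "Suc n"] n t by (intro mult_left_le_one_le) auto
  then have s: "0 \<le> s" "s \<le> T" using l(1)[of "Suc n"] n t by (auto simp: s_def)
  have "comp_upto n (\<lambda>i. P i (l i * t)) f =
      (\<lambda>z. remainder n m t f z + (\<Sum>q\<in>?M. c q * iterated n q f z))"
    by (simp add: remainder_def c_def)
  then have "comp_upto (Suc n) (\<lambda>i. P i (l i * t)) f =
      ?P (\<lambda>z. remainder n m t f z + (\<Sum>q\<in>?M. c q * iterated n q f z))"
    by (simp add: comp_upto_Suc s_def)
  also have "\<dots> = (\<lambda>z. ?P (remainder n m t f) z + (\<Sum>q\<in>?M. c q * ?P (iterated n q f) z))"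
    using n by (intro linear_op_on_sum[OF P_linear[where L = L]] s finite_multi_indices rem iter) auto
  finally have comp: "comp_upto (Suc n) (\<lambda>i. P i (l i * t)) f z =
      ?P (remainder n m t f) z + (\<Sum>q\<in>?M. c q * ?P (iterated n q f) z)"
    by simp
  \<comment> \<open>The last entry contributes \<open>l (Suc n) ^ r * t ^ r = s ^ r\<close>. Summed
    over \<open>r\<close>, these terms form the expansion of the last operator at time
    \<open>s\<close>, cut at the order that \<open>single_remainder\<close> subtracts.\<close>
  have "coeff (Suc n) (q(Suc n := r)) * t ^ (\<Sum>i=1..Suc n. (q(Suc n := r)) i) *
      iterated (Suc n) (q(Suc n := r)) f z = c q * (s ^ r / fact r * (V (Suc n) ^^ r) (iterated n q f) z)"
    for q r
  proof -
    have "coeff (Suc n) (q(Suc n := r)) = coeff n q * (l (Suc n) ^ r / fact r)"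
    proof -
      have "(\<Prod>i=1..n. l i ^ (q(Suc n := r)) i) = (\<Prod>i=1..n. l i ^ q i)"
        "(\<Prod>i=1..n. fact ((q(Suc n := r)) i)) = (\<Prod>i=1..n. fact (q i) :: real)"
        by (auto intro!: prod.cong)
      then show ?thesis by (simp add: coeff_def)
    qed
    moreover have "iterated (Suc n) (q(Suc n := r)) f = (V (Suc n) ^^ r) (iterated n q f)"
    proof -
      have "comp_upto n (\<lambda>i. V i ^^ (q(Suc n := r)) i) f = comp_upto n (\<lambda>i. V i ^^ q i) f"
        by (rule comp_upto_cong) auto
      then show ?thesis by (simp add: iterated_def comp_upto_Suc)
    qed
    moreover have "(\<Sum>i=1..Suc n. (q(Suc n := r)) i) = (\<Sum>i=1..n. q i) + r"
      using sum_fun_upd_Suc[of q n r] by simp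
    ultimately show ?thesis
      by (simp only: c_def s_def power_add power_mult_distrib) simp
  qed
  then have "(\<Sum>q\<in>multi_indices (Suc n) m.
        coeff (Suc n) q * t ^ (\<Sum>i=1..Suc n. q i) * iterated (Suc n) q f z) =
      (\<Sum>q\<in>?M. \<Sum>r<m - (\<Sum>i=1..n. q i). c q * (s ^ r / fact r * (V (Suc n) ^^ r) (iterated n q f) z))"
    unfolding sum_multi_indices_Suc by (simp only:)
  then have "remainder (Suc n) m t f z = ?P (remainder n m t f) z +
      (\<Sum>q\<in>?M. c q * single_remainder (Suc n) (m - (\<Sum>i=1..n. q i)) s (iterated n q f) z)"
    unfolding remainder_def[of "Suc n"] single_remainder_def comp
    by (simp add: right_diff_distrib sum_subtractf sum_distrib_left)
  then show "remainder (Suc n) m t f z = P (Suc n) (l (Suc n) * t) (remainder n m t f) z +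
    (\<Sum>q\<in>?M. coeff n q * t ^ (\<Sum>i=1..n. q i) *
       single_remainder (Suc n) (m - (\<Sum>i=1..n. q i)) (l (Suc n) * t) (iterated n q f) z)"
    by (simp add: s_def c_def)
qed

lemma remainder_bounded:
  assumes "n \<le> I" "m \<le> \<nu> + 1"
  shows "bounded_family T m (k + m * K) L k (L + m * \<Lambda>) (remainder n m)"
  using assms(1)
proof (induction n)
  case 0
  show ?case
  proof (cases "m = 0")
    case True
    then have "remainder 0 m = (\<lambda>t f. f)"
      by (simp add: remainder_def multi_indices_def comp_upto_0 fun_eq_iff)
    then show ?thesis using True bounded_family_id by simp
  next
    case False
    \<comment> \<open>For positive \<open>m\<close> the only multi-index of length 0 is the empty
      one; its term is \<open>f\<close> itself and cancels the empty composition. For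
      \<open>m = 0\<close> there is no term and \<open>f\<close> remains.\<close>
    then have "multi_indices 0 m = {\<lambda>_. undefined}"
      by (simp add: multi_indices_def)
    then have "remainder 0 m = (\<lambda>t f z. 0)"
      by (intro ext) (simp add: remainder_def comp_upto_0 iterated_def coeff_def)
    then show ?thesis by (simp add: bounded_family_zero)
  qed
next
  case (Suc n)
  then have n: "Suc n \<in> {1..I}" by simp
  \<comment> \<open>The same \<open>k\<close> and \<open>L\<close> suffice, because the last
    operator, taken with order 0, maps the target space boundedly to itself.\<close>
  have IH: "bounded_family T m (k + m * K) L k (L + m * \<Lambda>) (remainder n m)"
    using Suc by simp
  let ?s = "\<lambda>q. \<Sum>i=1..n. q i :: nat"
  have P: "bounded_family T j (k' + j * K) L' k' (L' + j * \<Lambda>)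
      (\<lambda>t. single_remainder (Suc n) j (l (Suc n) * t))" if "j \<le> m" for j k' L'
    unfolding single_remainder_def using that assms(2)
    by (intro bounded_family_rescale[OF P_bounded[OF n]] l n) auto
  \<comment> \<open>The generators use up \<open>?s q\<close> of the \<open>m\<close> units of loss.
    What is left pays exactly for a remainder of order \<open>m - ?s q\<close>; the subtraction is
    genuine since \<open>?s q < m\<close>.\<close>
  have iter: "bounded_family T 0 (k + m * K) L (k + (m - ?s q) * K) (L + ?s q * \<Lambda>) (\<lambda>t. iterated n q)"
    if q: "q \<in> multi_indices n m" for q
  proof -
    have "m = ?s q + (m - ?s q)" using q by (simp add: multi_indices_def)
    then have "k + m * K = k + (m - ?s q) * K + ?s q * K" by (metis add.assoc add.commute add_mult_distrib)
    then show ?thesis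
      using iterated_bounded[of n "k + (m - ?s q) * K" q L] Suc.prems by (simp only: Suc_leD)
  qed
  have "bounded_family T m (k + m * K) L k (L + m * \<Lambda>)
    (\<lambda>t f z. single_remainder (Suc n) 0 (l (Suc n) * t) (remainder n m t f) z)"
    \<comment> \<open>the remainder of order 0 is the operator \<open>P (Suc n)\<close> itself\<close>
    using bounded_family_compose[OF IH, of 0 k "L + m * \<Lambda>" "\<lambda>t. single_remainder (Suc n) 0 (l (Suc n) * t)"]
      P[of 0 k "L + m * \<Lambda>"] by simp
  moreover have "bounded_family T m (k + m * K) L k (L + m * \<Lambda>)
    (\<lambda>t f z. coeff n q * t ^ ?s q * single_remainder (Suc n) (m - ?s q) (l (Suc n) * t) (iterated n q f) z)"
    if q: "q \<in> multi_indices n m" for q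
  proof -
    have m: "?s q + (m - ?s q) = m" using q by (simp add: multi_indices_def)
    have \<Lambda>: "L + ?s q * \<Lambda> + (m - ?s q) * \<Lambda> = L + m * \<Lambda>"
      by (metis m add.assoc add_mult_distrib)
    show ?thesis
      using bounded_family_scale[OF bounded_family_compose[OF iter[OF q] P[of "m - ?s q"]],
          of "?s q" "coeff n q"]
      by (simp only: m \<Lambda> add_0 diff_le_self)
  qed
  ultimately have "bounded_family T m (k + m * K) L k (L + m * \<Lambda>)
    (\<lambda>t f z. single_remainder (Suc n) 0 (l (Suc n) * t) (remainder n m t f) z + (\<Sum>q\<in>multi_indices n m.
      coeff n q * t ^ ?s q * single_remainder (Suc n) (m - ?s q) (l (Suc n) * t) (iterated n q f) z))"
    by (intro bounded_family_add_sum finite_multi_indices)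
  then show ?case
  proof (rule bounded_family_cong)
    fix f t assume f: "f \<in> Cpol (k + m * K) L" and t: "0 \<le> t" "t \<le> T"
    \<comment> \<open>The recursion is an identity of functions, so regularity may be lowered to 0
      and growth raised to \<open>L + m * \<Lambda>\<close>, giving one space for all terms.\<close>
    have "remainder n m t f \<in> Cpol 0 (L + m * \<Lambda>)"
      using Cpol_mono(1)[OF bounded_family_mem[OF IH f t]] by simp
    moreover have "iterated n q f \<in> Cpol 0 (L + m * \<Lambda>)" if q: "q \<in> multi_indices n m" for q
    proof (rule Cpol_mono(1)[OF bounded_family_mem[OF iter[OF q] f t]])
      show "L + ?s q * \<Lambda> \<le> L + m * \<Lambda>" using q by (simp add: multi_indices_def)
    qed simp
    ultimately show "(\<lambda>z. single_remainder (Suc n) 0 (l (Suc n) * t) (remainder n m t f) z +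
        (\<Sum>q\<in>multi_indices n m. coeff n q * t ^ ?s q *
          single_remainder (Suc n) (m - ?s q) (l (Suc n) * t) (iterated n q f) z)) = remainder (Suc n) m t f"
      using remainder_Suc[OF Suc.prems t] by (simp add: single_remainder_def)
  qed
qed

end

section \<open>Passage from the individual losses to their maxima\<close>

theorem lemma1p2p12:
  fixes \<nu> I :: nat and T :: real
    and V :: "nat \<Rightarrow> fn \<Rightarrow> fn"
    and P :: "nat \<Rightarrow> real \<Rightarrow> fn \<Rightarrow> fn"
    and kk LL :: "nat \<Rightarrow> nat"
    and kstar Lstar :: nat
  assumes T_pos: "T > 0"
    and I_ge_1: "I \<ge> 1"
    and V_linear: "\<And>i L. i \<in> {1..I} \<Longrightarrow> linear_op_on (Cpol (kk i) L) (V i)"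
    and V_bound: "\<And>i k L. i \<in> {1..I} \<Longrightarrow>
          \<exists>C\<ge>0. \<forall>f\<in>Cpol (k + kk i) L.
            V i f \<in> Cpol k (L + LL i) \<and>
            pol_norm k (L + LL i) (V i f) \<le> C * pol_norm (k + kk i) L f"
    and kstar_def: "kstar = Max (kk ` {1..I})"
    and Lstar_def: "Lstar = Max (LL ` {1..I})"
    and P_linear: "\<And>i t L. i \<in> {1..I} \<Longrightarrow> t \<in> {0..T} \<Longrightarrow>
          linear_op_on (Cpol 0 L) (P i t) \<and> P i t ` Cpol 0 L \<subseteq> Cpol 0 L"
    and P_expansion: "\<And>i k L qb. i \<in> {1..I} \<Longrightarrow> qb \<le> \<nu> + 1 \<Longrightarrow>
          \<exists>C::real. \<forall>f\<in>Cpol (k + qb * kk i) L. \<forall>t\<in>{0..T}.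
            (let g = (\<lambda>z. P i t f z - (\<Sum>q<qb. t ^ q / fact q * (V i ^^ q) f z)) in
              g \<in> Cpol k (L + qb * LL i) \<and>
              pol_norm k (L + qb * LL i) g \<le> C * t ^ qb * pol_norm (k + qb * kk i) L f)"
  shows "\<forall>l :: nat \<Rightarrow> real. (\<forall>i\<in>{1..I}. l i \<in> {0..1}) \<longrightarrow>
          (\<forall>k L qb. qb \<le> \<nu> + 1 \<longrightarrow>
            (\<exists>C::real. \<forall>f\<in>Cpol (k + qb * kstar) L. \<forall>t\<in>{0..T}.
              (let g = (\<lambda>z. comp_upto I (\<lambda>i. P i (l i * t)) f z -
                     (\<Sum>q\<in>multi_indices I qb.
                        (\<Prod>i=1..I. l i ^ q i) * t ^ (\<Sum>i=1..I. q i) / (\<Prod>i=1..I. fact (q i)) *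
                        comp_upto I (\<lambda>i. V i ^^ q i) f z)) in
                g \<in> Cpol k (L + qb * Lstar) \<and>
                pol_norm k (L + qb * Lstar) g
                  \<le> C * t ^ qb * pol_norm (k + qb * kstar) L f)))"
proof (intro allI impI)
  fix l :: "nat \<Rightarrow> real" and k L qb :: nat
  assume l: "\<forall>i\<in>{1..I}. l i \<in> {0..1}" and qb: "qb \<le> \<nu> + 1"
  have le: "kk i \<le> kstar" "LL i \<le> Lstar" if "i \<in> {1..I}" for i
    using that by (auto simp: kstar_def Lstar_def)
  \<comment> \<open>Each hypothesis is first read as a \<open>bounded_family\<close> with the losses
    of its own operator, then weakened to the maxima.\<close>
  interpret expansion \<nu> I T V P kstar Lstar l
  proof
    fix i k L assume i: "i \<in> {1..I}"
    have "bounded_family T 0 (k + kk i) L k (L + LL i) (\<lambda>t. V i)"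
      using V_bound[OF i, of k L] unfolding bounded_family_def by auto
    then show "bounded_family T 0 (k + kstar) L k (L + Lstar) (\<lambda>t. V i)"
      by (rule bounded_family_weaken) (use le[OF i] in auto)
  next
    fix i m k L assume i: "i \<in> {1..I}" and m: "m \<le> \<nu> + 1"
    obtain C where "\<forall>f\<in>Cpol (k + m * kk i) L. \<forall>t\<in>{0..T}.
        (let g = (\<lambda>z. P i t f z - (\<Sum>q<m. t ^ q / fact q * (V i ^^ q) f z)) in
          g \<in> Cpol k (L + m * LL i) \<and>
          pol_norm k (L + m * LL i) g \<le> C * t ^ m * pol_norm (k + m * kk i) L f)"
      using P_expansion[OF i m] by blast
    then have "bounded_family T m (k + m * kk i) L k (L + m * LL i)
        (\<lambda>t f z. P i t f z - (\<Sum>q<m. t ^ q / fact q * (V i ^^ q) f z))"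
      unfolding Let_def by (intro bounded_familyI[where C = C]) auto
    then show "bounded_family T m (k + m * kstar) L k (L + m * Lstar)
        (\<lambda>t f z. P i t f z - (\<Sum>q<m. t ^ q / fact q * (V i ^^ q) f z))"
      by (rule bounded_family_weaken) (use le[OF i] in auto)
  qed (use P_linear l in auto)
  have eq: "remainder I qb t f = (\<lambda>z. comp_upto I (\<lambda>i. P i (l i * t)) f z -
      (\<Sum>q\<in>multi_indices I qb.
        (\<Prod>i=1..I. l i ^ q i) * t ^ (\<Sum>i=1..I. q i) / (\<Prod>i=1..I. fact (q i)) *
        comp_upto I (\<lambda>i. V i ^^ q i) f z))" for t f
    by (simp add: remainder_def coeff_def iterated_def)
  have "bounded_family T qb (k + qb * kstar) L k (L + qb * Lstar) (remainder I qb)"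
    by (rule remainder_bounded[OF order_refl qb])
  then show "\<exists>C::real. \<forall>f\<in>Cpol (k + qb * kstar) L. \<forall>t\<in>{0..T}.
      (let g = (\<lambda>z. comp_upto I (\<lambda>i. P i (l i * t)) f z -
             (\<Sum>q\<in>multi_indices I qb.
                (\<Prod>i=1..I. l i ^ q i) * t ^ (\<Sum>i=1..I. q i) / (\<Prod>i=1..I. fact (q i)) *
                comp_upto I (\<lambda>i. V i ^^ q i) f z)) in
        g \<in> Cpol k (L + qb * Lstar) \<and>
        pol_norm k (L + qb * Lstar) g
          \<le> C * t ^ qb * pol_norm (k + qb * kstar) L f)"
    unfolding bounded_family_def Let_def eq by blast
qed

end
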